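(* Let $u\in V$ be quasiprimary of weight $N\ge1$ and let $v_1,\ldots,v_n\in V$ be inserted at $y_1,\ldots,y_n$. Then for every polynomial $p$ with complex coefficients of degree at most $2N-2$, $$\sum_{k=1}^n\sum_{\ell=0}^{2N-2}p^{(\ell)}(y_k)\,Z^{(0)}(\ldots;u(\ell)v_k,y_k;\ldots)=0,$$ where $v_k$ is replaced by $u(\ell)v_k$ and the other insertions are unchanged.
   Context: $V=(V,Y,\mathbf 1,\omega)$ is a simple vertex operator algebra over $\mathbb C$ of strong CFT type ($V=\bigoplus_{n\ge0}V_n$, $\dim V_n<\infty$, $V_0=\mathbb C\mathbf 1$, $L(1)V_1=0$), isomorphic to its contragredient module $V'$. $Y(u,z)=\sum_nu(n)z^{-n-1}$, $Y(\omega,z)=\sum_nL(n)z^{-n-2}$. $u$ is quasiprimary of weight $N$ if $u\in V_N$ and $L(1)u=0$. $\langle\cdot,\cdot\rangle$ is the unique non-degenerate invariant bilinear form on $V$ with $\langle\mathbf 1,\mathbf 1\rangle=1$: $\langle Y(u,z)v,w\rangle=\langle v,Y(e^{zL(1)}(-z^{-2})^{L(0)}u,z^{-1})w\rangle$. $Z^{(0)}(v_1,y_1;\ldots;v_n,y_n)=\langle\mathbf 1,Y(v_1,y_1)\cdots Y(v_n,y_n)\mathbf 1\rangle$, extended to a rational function of $y_1,\ldots,y_n$. $p^{(\ell)}(y)=\frac1{\ell!}\frac{d^\ell p}{dy^\ell}(y)$. *)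

theory Defs
  imports "HOL-Analysis.Infinite_Sum" "HOL-Library.Groups_Big_Fun" "HOL-Library.FuncSet"
    "HOL-Computational_Algebra.Polynomial"
begin

section \<open>Vertex operator algebras\<close>

text \<open>
  The underlying vector space is the whole type. The field \<open>mode\<close> holds the Fourier modes
  of the state-field map: \<open>mode V u n v\<close> is \<open>u(n)v\<close>, where \<open>Y(u,z) = \<Sum>n. u(n) z^(-n-1)\<close>.
\<close>

record 'v vertex_data =
  scal :: "complex \<Rightarrow> 'v \<Rightarrow> 'v"
  mode :: "'v \<Rightarrow> int \<Rightarrow> 'v \<Rightarrow> 'v"
  vac :: 'v
  conf :: 'v

definition vir :: "'v vertex_data \<Rightarrow> int \<Rightarrow> 'v \<Rightarrow> 'v" where
  "vir V n = mode V (conf V) (n + 1)"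

definition wt_space :: "'v vertex_data \<Rightarrow> int \<Rightarrow> 'v set" where
  "wt_space V n = {v. vir V 0 v = scal V (of_int n) v}"

text \<open>
  The axiom \<open>jacobi\<close> is the coefficient of \<open>z0^(-l-1) z1^(-m-1) z2^(-n-1)\<close> in the Jacobi identity;
  by \<open>truncation\<close> its sums have finite support. In \<open>grading\<close> the sum of the weight spaces is
  automatically direct, since these are eigenspaces of \<open>L(0)\<close>.
\<close>

locale vertex_operator_algebra = vector_space "scal V"
  for V :: "'v::ab_group_add vertex_data" +
  assumes mode_linear_left: "Vector_Spaces.linear (scal V) (scal V) (\<lambda>u. mode V u n v)"
    and mode_linear_right: "Vector_Spaces.linear (scal V) (scal V) (mode V u n)"
    and truncation: "\<exists>M. \<forall>n\<ge>M. mode V u n v = 0"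
    and vacuum: "mode V (vac V) n v = (if n = -1 then v else 0)"
    and creation: "mode V u (-1) (vac V) = u"
      "n \<ge> 0 \<Longrightarrow> mode V u n (vac V) = 0"
    and jacobi: "Sum_any (\<lambda>i::nat. scal V (of_int m gchoose i)
          (mode V (mode V u (l + int i) v) (m + n - int i) w)) =
        Sum_any (\<lambda>i::nat. scal V ((-1) ^ i * (of_int l gchoose i))
          (mode V u (l + m - int i) (mode V v (n + int i) w)
           - scal V ((-1) powi l) (mode V v (l + n - int i) (mode V u (m + int i) w))))"
    and virasoro: "\<exists>c::complex. \<forall>m n v. vir V m (vir V n v) - vir V n (vir V m v) =
        scal V (of_int (m - n)) (vir V (m + n) v)
        + (if m + n = 0 then scal V (of_int (m ^ 3 - m) / 12 * c) v else 0)"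
    and translation: "mode V (vir V (-1) u) n v = scal V (- of_int n) (mode V u (n - 1) v)"
    and grading: "span (\<Union>n. wt_space V n) = UNIV"
    and finite_dim: "\<exists>B. finite B \<and> wt_space V n = span B"
    and bounded_below: "\<exists>M. \<forall>n<M. wt_space V n = {0}"

definition voa_ideal :: "'v::ab_group_add vertex_data \<Rightarrow> 'v set \<Rightarrow> bool" where
  "voa_ideal V I \<longleftrightarrow> module.subspace (scal V) I \<and>
     (\<forall>u n. \<forall>w\<in>I. mode V u n w \<in> I \<and> mode V w n u \<in> I)"

definition simple_voa :: "'v::ab_group_add vertex_data \<Rightarrow> bool" where
  "simple_voa V \<longleftrightarrow> (UNIV :: 'v set) \<noteq> {0} \<and> (\<forall>I. voa_ideal V I \<longrightarrow> I = {0} \<or> I = UNIV)"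

definition strong_cft_type :: "'v::ab_group_add vertex_data \<Rightarrow> bool" where
  "strong_cft_type V \<longleftrightarrow> (\<forall>n<0. wt_space V n = {0}) \<and>
     wt_space V 0 = module.span (scal V) {vac V} \<and>
     (\<forall>v\<in>wt_space V 1. vir V 1 v = 0)"

definition quasiprimary :: "'v::ab_group_add vertex_data \<Rightarrow> nat \<Rightarrow> 'v \<Rightarrow> bool" where
  "quasiprimary V N u \<longleftrightarrow> u \<in> wt_space V (int N) \<and> vir V 1 u = 0"


section \<open>The contragredient module and the invariant form\<close>

definition wt_component :: "'v::ab_group_add vertex_data \<Rightarrow> 'v \<Rightarrow> int \<Rightarrow> 'v" where
  "wt_component V v = (THE h. (\<forall>n. h n \<in> wt_space V n) \<and> finite {n. h n \<noteq> 0} \<and> Sum_any h = v)"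

text \<open>
  \<open>opp_mode V u n w\<close> is the coefficient of \<open>z^(-n-1)\<close> in
  \<open>Y(exp(z L(1)) (-z^(-2))^L(0) u, z^(-1)) w\<close>. A component \<open>a\<close> of \<open>u\<close> of weight \<open>k\<close>
  contributes \<open>(-1)^k z^(j-2k) / j! * Y(L(1)^j a, z^(-1)) w\<close> for each \<open>j\<close>, and the mode
  \<open>m\<close> of the latter field comes with \<open>z^(m+1)\<close>.
\<close>

definition opp_mode :: "'v::ab_group_add vertex_data \<Rightarrow> 'v \<Rightarrow> int \<Rightarrow> 'v \<Rightarrow> 'v" where
  "opp_mode V u n w = Sum_any (\<lambda>k::int. Sum_any (\<lambda>j::nat.
     scal V ((-1) powi k / fact j)
       (mode V ((vir V 1 ^^ j) (wt_component V u k)) (2 * k - int j - n - 2) w)))"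

definition restricted_dual :: "'v::ab_group_add vertex_data \<Rightarrow> ('v \<Rightarrow> complex) set" where
  "restricted_dual V = {f. Vector_Spaces.linear (scal V) (*) f \<and>
     finite {n. \<exists>v\<in>wt_space V n. f v \<noteq> 0}}"

definition contragredient_mode ::
    "'v::ab_group_add vertex_data \<Rightarrow> 'v \<Rightarrow> int \<Rightarrow> ('v \<Rightarrow> complex) \<Rightarrow> 'v \<Rightarrow> complex" where
  "contragredient_mode V u n f = (\<lambda>w. f (opp_mode V u n w))"

definition iso_to_contragredient :: "'v::ab_group_add vertex_data \<Rightarrow> bool" where
  "iso_to_contragredient V \<longleftrightarrow> (\<exists>\<phi>. bij_betw \<phi> UNIV (restricted_dual V) \<and>
     (\<forall>w. Vector_Spaces.linear (scal V) (*) (\<lambda>v. \<phi> v w)) \<and>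
     (\<forall>u n v. \<phi> (mode V u n v) = contragredient_mode V u n (\<phi> v)))"

definition normalized_invariant_form ::
    "'v::ab_group_add vertex_data \<Rightarrow> ('v \<Rightarrow> 'v \<Rightarrow> complex) \<Rightarrow> bool" where
  "normalized_invariant_form V B \<longleftrightarrow>
     (\<forall>w. Vector_Spaces.linear (scal V) (*) (\<lambda>v. B v w)) \<and>
     (\<forall>v. Vector_Spaces.linear (scal V) (*) (B v)) \<and>
     (\<forall>v. (\<forall>w. B v w = 0) \<longrightarrow> v = 0) \<and> (\<forall>w. (\<forall>v. B v w = 0) \<longrightarrow> w = 0) \<and>
     (\<forall>u n v w. B (mode V u n v) w = B v (opp_mode V u n w)) \<and>
     B (vac V) (vac V) = 1"

definition invariant_form :: "'v::ab_group_add vertex_data \<Rightarrow> 'v \<Rightarrow> 'v \<Rightarrow> complex" where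
  "invariant_form V = (THE B. normalized_invariant_form V B)"


section \<open>Genus-zero correlation functions\<close>

definition config_space :: "nat \<Rightarrow> complex list set" where
  "config_space n = {ys. length ys = n \<and> distinct ys}"

definition radially_ordered :: "nat \<Rightarrow> complex list set" where
  "radially_ordered n =
     {ys. length ys = n \<and> sorted_wrt (\<lambda>a b. norm a > norm b) ys \<and> 0 \<notin> set ys}"

definition polynomial_fun :: "nat \<Rightarrow> (complex list \<Rightarrow> complex) \<Rightarrow> bool" where
  "polynomial_fun n f \<longleftrightarrow> (\<exists>A c. finite A \<and> A \<subseteq> {a :: nat list. length a = n} \<and>
     (\<forall>ys. length ys = n \<longrightarrow> f ys = (\<Sum>a\<in>A. c a * (\<Prod>i<n. ys ! i ^ (a ! i)))))"

definition rational_on_config :: "nat \<Rightarrow> (complex list \<Rightarrow> complex) \<Rightarrow> bool" where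
  "rational_on_config n R \<longleftrightarrow> (\<exists>P Q. polynomial_fun n P \<and> polynomial_fun n Q \<and>
     (\<forall>ys\<in>config_space n. Q ys \<noteq> 0 \<and> R ys = P ys / Q ys))"

text \<open>The coefficient of \<open>\<Prod>i. y_i^(-m_i-1)\<close> in \<open>\<langle>1, Y(v_1,y_1) \<dots> Y(v_n,y_n) 1\<rangle>\<close>.\<close>

definition correlator_coeff :: "'v::ab_group_add vertex_data \<Rightarrow> 'v list \<Rightarrow> int list \<Rightarrow> complex" where
  "correlator_coeff V vs ms =
     invariant_form V (vac V) (foldr (\<lambda>(v, m) w. mode V v m w) (zip vs ms) (vac V))"

text \<open>
  The series converges (absolutely) for \<open>|y_1| > \<dots> > |y_n| > 0\<close>, to a rational function whose only
  possible poles are at \<open>y_i = y_j\<close>. That function is represented by its values on the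
  configuration space of distinct points, where it is regular; these determine it, and
  \<open>extensional\<close> fixes an irrelevant value elsewhere.
\<close>

definition correlator :: "'v::ab_group_add vertex_data \<Rightarrow> 'v list \<Rightarrow> complex list \<Rightarrow> complex" where
  "correlator V vs = (let n = length vs in
     THE R. R \<in> extensional (config_space n) \<and> rational_on_config n R \<and>
       (\<forall>ys\<in>radially_ordered n.
          ((\<lambda>ms. correlator_coeff V vs ms * (\<Prod>i<n. (ys ! i) powi (- (ms ! i) - 1)))
             has_sum R ys) {ms. length ms = n}))"

end

theory Submission
  imports Defs "HOL-Analysis.Generalised_Binomial_Theorem"
begin

text \<open>
  The identity is the invariance of genus-zero correlators under the modes \<open>u(m)\<close> with
  \<open>0 \<le> m \<le> 2N - 2\<close>. Such a mode annihilates the vacuum, and since \<open>u\<close> is quasiprimary its adjoint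
  for the invariant form is \<open>\<plusminus>u(2N - 2 - m)\<close>, which annihilates the vacuum as well. Hence
  \<open>\<langle>1, u(m) v_1(m_1) \<dots> v_n(m_n) 1\<rangle> = 0\<close> (\<open>vev_quasiprimary\<close>). Moving \<open>u(m)\<close> to the right with the
  commutator formula \<open>[u(m), v(n)] = \<Sum>i. (m choose i) (u(i)v)(m + n - i)\<close> turns this into a
  linear relation among correlator coefficients (\<open>mode_string_commutator\<close>). Multiplied by
  \<open>\<Prod>k. y_k^(-m_k-1)\<close> and summed over all exponents, it becomes the claim for \<open>p(y) = y^m\<close>, because
  \<open>(m choose i) y^(m-i)\<close> is the \<open>i\<close>-th derivative of \<open>y^m\<close> divided by \<open>i!\<close>. Linearity in \<open>p\<close> gives
  the general case.

  The summation takes place where \<open>|y_1| > \<dots> > |y_n| > 0\<close>; the result extends to all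
  configurations because a rational function that vanishes on this region vanishes identically
  (\<open>rational_on_config_vanishes\<close>).

  For this argument the correlators must exist, which also rests on the commutator formula. Up to
  a multiple of the vacuum, which inserts nothing, every state \<open>a\<close> satisfies \<open>\<langle>1, a(m) w\<rangle> = 0\<close> for
  all \<open>m < 0\<close>, by weight reasons (\<open>vacuum_plus_annihilated\<close>). So only the modes \<open>a(m)\<close> with
  \<open>m \<ge> 0\<close> contribute to an insertion of \<open>a\<close> at \<open>z\<close>; these can be moved to the right, and the sums
  over \<open>m\<close> are negative binomial series. The outcome, for such \<open>a\<close>, is the recursion
  \<open>Z(a,z; v_1,y_1; \<dots>) = \<Sum>k. \<Sum>i\<ge>0. (z - y_k)^(-i-1) Z(\<dots>; a(i)v_k,y_k; \<dots>)\<close>,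
  which yields absolute convergence and rationality by induction on the number of insertions
  (\<open>correlator_expansion_Cons\<close>). The invariant form itself is the pairing given by the isomorphism
  with the contragredient module, scaled so that the vacuum has norm 1; it is unique because it is
  determined by the functional \<open>\<langle>1, \<cdot>\<rangle>\<close>, which lives on the one-dimensional weight space 0.
\<close>

section \<open>Rational functions on configuration spaces\<close>

lemma polynomial_funE:
  assumes "polynomial_fun n f"
  obtains A c where "finite A" "A \<subseteq> {a :: nat list. length a = n}"
    "\<And>ys. length ys = n \<Longrightarrow> f ys = (\<Sum>a\<in>A. c a * (\<Prod>i<n. ys ! i ^ (a ! i)))"
  using assms unfolding polynomial_fun_def by blast

lemma rational_on_configE:
  assumes "rational_on_config n R"
  obtains P Q where "polynomial_fun n P" "polynomial_fun n Q"
    "\<And>ys. ys \<in> config_space n \<Longrightarrow> Q ys \<noteq> 0 \<and> R ys = P ys / Q ys"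
  using assms unfolding rational_on_config_def by blast

lemma polynomial_fun_cong:
  assumes "polynomial_fun n f" "\<And>ys. length ys = n \<Longrightarrow> g ys = f ys"
  shows "polynomial_fun n g"
  using assms unfolding polynomial_fun_def by simp

lemma polynomial_fun_monom:
  assumes "length a = n"
  shows "polynomial_fun n (\<lambda>ys. c * (\<Prod>i<n. ys ! i ^ (a ! i)))"
  unfolding polynomial_fun_def
  by (rule exI[of _ "{a}"], rule exI[of _ "\<lambda>_. c"]) (use assms in auto)

lemma polynomial_fun_const: "polynomial_fun n (\<lambda>ys. c)"
  by (rule polynomial_fun_cong[OF polynomial_fun_monom[of "replicate n 0" n c]]) auto

lemma polynomial_fun_add:
  assumes "polynomial_fun n f" "polynomial_fun n g"
  shows "polynomial_fun n (\<lambda>ys. f ys + g ys)"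
proof -
  let ?M = "\<lambda>(a :: nat list) ys. \<Prod>i<n. (ys ! i :: complex) ^ (a ! i)"
  obtain A c where A: "finite A" "A \<subseteq> {a. length a = n}"
      "\<And>ys. length ys = n \<Longrightarrow> f ys = (\<Sum>a\<in>A. c a * ?M a ys)"
    using assms(1) by (rule polynomial_funE) blast
  obtain B d where B: "finite B" "B \<subseteq> {a. length a = n}"
      "\<And>ys. length ys = n \<Longrightarrow> g ys = (\<Sum>a\<in>B. d a * ?M a ys)"
    using assms(2) by (rule polynomial_funE) blast
  let ?e = "\<lambda>a. (if a \<in> A then c a else 0) + (if a \<in> B then d a else 0)"
  have "f ys + g ys = (\<Sum>a\<in>A \<union> B. ?e a * ?M a ys)" if "length ys = n" for ys
  proof -
    have "(\<Sum>a\<in>A. c a * ?M a ys) = (\<Sum>a\<in>A \<union> B. (if a \<in> A then c a else 0) * ?M a ys)"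
      using A(1) B(1) by (intro sum.mono_neutral_cong_left) auto
    moreover have "(\<Sum>a\<in>B. d a * ?M a ys) = (\<Sum>a\<in>A \<union> B. (if a \<in> B then d a else 0) * ?M a ys)"
      using A(1) B(1) by (intro sum.mono_neutral_cong_left) auto
    ultimately show ?thesis
      using that by (simp add: A(3) B(3) distrib_right sum.distrib)
  qed
  then show ?thesis
    unfolding polynomial_fun_def using A(1,2) B(1,2)
    by (intro exI[of _ "A \<union> B"] exI[of _ ?e]) auto
qed

lemma polynomial_fun_sum:
  assumes "\<And>j. j \<in> J \<Longrightarrow> polynomial_fun n (f j)"
  shows "polynomial_fun n (\<lambda>ys. \<Sum>j\<in>J. f j ys)"
  using assms by (induction J rule: infinite_finite_induct)
    (auto intro: polynomial_fun_const polynomial_fun_add)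

lemma polynomial_fun_mult:
  assumes "polynomial_fun n f" "polynomial_fun n g"
  shows "polynomial_fun n (\<lambda>ys. f ys * g ys)"
proof -
  let ?M = "\<lambda>(a :: nat list) ys. \<Prod>i<n. (ys ! i :: complex) ^ (a ! i)"
  obtain A c where A: "finite A" "A \<subseteq> {a. length a = n}"
      "\<And>ys. length ys = n \<Longrightarrow> f ys = (\<Sum>a\<in>A. c a * ?M a ys)"
    using assms(1) by (rule polynomial_funE) blast
  obtain B d where B: "finite B" "B \<subseteq> {a. length a = n}"
      "\<And>ys. length ys = n \<Longrightarrow> g ys = (\<Sum>a\<in>B. d a * ?M a ys)"
    using assms(2) by (rule polynomial_funE) blast
  have "polynomial_fun n (\<lambda>ys. \<Sum>a\<in>A. \<Sum>b\<in>B. (c a * d b) * ?M (map2 (+) a b) ys)"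
    using A(2) B(2) by (intro polynomial_fun_sum polynomial_fun_monom) (simp add: subset_iff)
  then show ?thesis
  proof (rule polynomial_fun_cong)
    fix ys :: "complex list" assume ys: "length ys = n"
    have "?M (map2 (+) a b) ys = ?M a ys * ?M b ys" if "a \<in> A" "b \<in> B" for a b
    proof -
      have "length a = n" "length b = n" using that A(2) B(2) by auto
      then show ?thesis by (auto simp: power_add prod.distrib[symmetric] intro!: prod.cong)
    qed
    then show "f ys * g ys = (\<Sum>a\<in>A. \<Sum>b\<in>B. (c a * d b) * ?M (map2 (+) a b) ys)"
      by (auto simp: A(3)[OF ys] B(3)[OF ys] sum_product mult_ac intro!: sum.cong)
  qed
qed

lemma polynomial_fun_power:
  "polynomial_fun n f \<Longrightarrow> polynomial_fun n (\<lambda>ys. f ys ^ k)"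
  by (induction k) (auto intro: polynomial_fun_const polynomial_fun_mult)

lemma polynomial_fun_nth:
  assumes "k < n"
  shows "polynomial_fun n (\<lambda>ys. ys ! k)"
proof (rule polynomial_fun_cong[OF polynomial_fun_monom])
  show "length ((replicate n 0)[k := Suc 0]) = n" by simp
  fix ys :: "complex list"
  have "(\<Prod>i<n. ys ! i ^ ((replicate n 0)[k := Suc 0] ! i)) = (\<Prod>i<n. if i = k then ys ! i else 1)"
    by (intro prod.cong) (auto simp: nth_list_update)
  then show "ys ! k = 1 * (\<Prod>i<n. ys ! i ^ ((replicate n 0)[k := Suc 0] ! i))"
    using assms by (simp add: prod.delta)
qed

lemma polynomial_fun_tl:
  assumes "polynomial_fun n f"
  shows "polynomial_fun (Suc n) (\<lambda>ys. f (tl ys))"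
proof -
  obtain A c where A: "finite A" "A \<subseteq> {a. length a = n}"
      "\<And>ys. length ys = n \<Longrightarrow> f ys = (\<Sum>a\<in>A. c a * (\<Prod>i<n. ys ! i ^ (a ! i)))"
    using assms by (rule polynomial_funE) blast
  have "polynomial_fun (Suc n) (\<lambda>ys. \<Sum>a\<in>A. c a * (\<Prod>i<Suc n. ys ! i ^ ((0 # a) ! i)))"
    using A(2) by (intro polynomial_fun_sum polynomial_fun_monom) auto
  then show ?thesis
    by (rule polynomial_fun_cong)
      (auto simp: A(3) prod.lessThan_Suc_shift nth_tl simp del: prod.lessThan_Suc intro!: sum.cong)
qed

lemma polynomial_fun_Cons:
  assumes "polynomial_fun (Suc n) f"
  shows "polynomial_fun n (\<lambda>ys. f (z # ys))"
    and "length ys = n \<Longrightarrow> \<exists>q. \<forall>z. f (z # ys) = poly q z"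
proof -
  obtain A c where A: "finite A" "A \<subseteq> {a. length a = Suc n}"
      "\<And>ys. length ys = Suc n \<Longrightarrow> f ys = (\<Sum>a\<in>A. c a * (\<Prod>i<Suc n. ys ! i ^ (a ! i)))"
    using assms by (rule polynomial_funE) blast
  have exp: "f (z # ys) = (\<Sum>a\<in>A. (c a * z ^ hd a) * (\<Prod>i<n. ys ! i ^ (tl a ! i)))"
    if "length ys = n" for z ys
  proof -
    have "(\<Prod>i<Suc n. (z # ys) ! i ^ (a ! i)) = z ^ hd a * (\<Prod>i<n. ys ! i ^ (tl a ! i))"
      if "a \<in> A" for a
      using that A(2) by (cases a) (auto simp: prod.lessThan_Suc_shift simp del: prod.lessThan_Suc)
    then show ?thesis
      using that by (auto simp: A(3) simp del: prod.lessThan_Suc intro!: sum.cong)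
  qed
  show "polynomial_fun n (\<lambda>ys. f (z # ys))"
    by (rule polynomial_fun_cong[OF polynomial_fun_sum[OF polynomial_fun_monom] exp])
      (use A(2) in auto)
  show "\<exists>q. \<forall>z. f (z # ys) = poly q z" if "length ys = n"
    by (rule exI[of _ "\<Sum>a\<in>A. monom (c a * (\<Prod>i<n. ys ! i ^ (tl a ! i))) (hd a)"])
      (auto simp: exp[OF that] poly_sum poly_monom mult_ac intro!: sum.cong)
qed

text \<open>
  Induction on the number of variables. For a fixed radially ordered tail, the polynomial in the
  first variable vanishes outside a disc, hence identically; for a fixed value of the first
  variable, what is left then vanishes on radially ordered tails.
\<close>

lemma polynomial_fun_vanishes:
  assumes "polynomial_fun n f" "\<And>ys. ys \<in> radially_ordered n \<Longrightarrow> f ys = 0" "length ys = n"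
  shows "f ys = 0"
  using assms
proof (induction n arbitrary: f ys)
  case 0
  then show ?case by (simp add: radially_ordered_def)
next
  case (Suc n)
  have tail: "f (z # zs) = 0" if zs: "zs \<in> radially_ordered n" for z zs
  proof -
    have len: "length zs = n" using zs by (simp add: radially_ordered_def)
    obtain q where q: "\<And>z. f (z # zs) = poly q z"
      using polynomial_fun_Cons(2)[OF Suc.prems(1) len] by blast
    define r where "r = Max (insert 0 (norm ` set zs))"
    have r: "0 \<le> r" "\<And>y. y \<in> set zs \<Longrightarrow> norm y \<le> r"
      by (auto simp: r_def intro: Max_ge)
    have "complex_of_real ` {r<..} \<subseteq> {z. poly q z = 0}"
    proof clarify
      fix x :: real assume "r < x"
      then have "complex_of_real x # zs \<in> radially_ordered (Suc n)"
        using zs r by (fastforce simp: radially_ordered_def)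
      then show "poly q (complex_of_real x) = 0"
        using Suc.prems(2) q by metis
    qed
    moreover have "infinite (complex_of_real ` {r<..})"
      by (subst finite_image_iff) (auto simp: inj_on_def infinite_Ioi)
    ultimately have "q = 0"
      using poly_roots_finite finite_subset by blast
    then show ?thesis using q by simp
  qed
  obtain z zs where ys: "ys = z # zs" "length zs = n"
    using Suc.prems(3) by (cases ys) auto
  show ?case
    unfolding ys(1)
    by (rule Suc.IH[OF polynomial_fun_Cons(1)[OF Suc.prems(1)] tail ys(2)])
qed

lemma rational_on_config_cong:
  assumes "rational_on_config n R" "\<And>ys. ys \<in> config_space n \<Longrightarrow> S ys = R ys"
  shows "rational_on_config n S"
  using assms unfolding rational_on_config_def by metis

lemma rational_on_config_quotient:
  assumes "polynomial_fun n P" "polynomial_fun n Q"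
    "\<And>ys. ys \<in> config_space n \<Longrightarrow> Q ys \<noteq> 0"
  shows "rational_on_config n (\<lambda>ys. P ys / Q ys)"
  using assms unfolding rational_on_config_def by blast

lemma rational_on_config_polynomial:
  "polynomial_fun n P \<Longrightarrow> rational_on_config n P"
  using rational_on_config_quotient[OF _ polynomial_fun_const[of n 1]] by simp

lemma rational_on_config_add:
  assumes "rational_on_config n R" "rational_on_config n S"
  shows "rational_on_config n (\<lambda>ys. R ys + S ys)"
proof -
  obtain P Q where R: "polynomial_fun n P" "polynomial_fun n Q"
    "\<And>ys. ys \<in> config_space n \<Longrightarrow> Q ys \<noteq> 0 \<and> R ys = P ys / Q ys"
    using assms(1) by (rule rational_on_configE) blast
  obtain P' Q' where S: "polynomial_fun n P'" "polynomial_fun n Q'"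
    "\<And>ys. ys \<in> config_space n \<Longrightarrow> Q' ys \<noteq> 0 \<and> S ys = P' ys / Q' ys"
    using assms(2) by (rule rational_on_configE) blast
  show ?thesis
    by (rule rational_on_config_cong[OF rational_on_config_quotient[OF
            polynomial_fun_add[OF polynomial_fun_mult[OF R(1) S(2)] polynomial_fun_mult[OF S(1) R(2)]]
            polynomial_fun_mult[OF R(2) S(2)]]])
      (use R(3) S(3) in \<open>auto simp: field_simps\<close>)
qed

lemma rational_on_config_mult:
  assumes "rational_on_config n R" "rational_on_config n S"
  shows "rational_on_config n (\<lambda>ys. R ys * S ys)"
proof -
  obtain P Q where R: "polynomial_fun n P" "polynomial_fun n Q"
    "\<And>ys. ys \<in> config_space n \<Longrightarrow> Q ys \<noteq> 0 \<and> R ys = P ys / Q ys"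
    using assms(1) by (rule rational_on_configE) blast
  obtain P' Q' where S: "polynomial_fun n P'" "polynomial_fun n Q'"
    "\<And>ys. ys \<in> config_space n \<Longrightarrow> Q' ys \<noteq> 0 \<and> S ys = P' ys / Q' ys"
    using assms(2) by (rule rational_on_configE) blast
  show ?thesis
    by (rule rational_on_config_cong[OF rational_on_config_quotient[OF
            polynomial_fun_mult[OF R(1) S(1)] polynomial_fun_mult[OF R(2) S(2)]]])
      (use R(3) S(3) in auto)
qed

lemma rational_on_config_sum:
  assumes "\<And>j. j \<in> J \<Longrightarrow> rational_on_config n (R j)"
  shows "rational_on_config n (\<lambda>ys. \<Sum>j\<in>J. R j ys)"
  using assms by (induction J rule: infinite_finite_induct)
    (auto intro: rational_on_config_polynomial polynomial_fun_const rational_on_config_add)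

lemma rational_on_config_tl:
  assumes "rational_on_config n R"
  shows "rational_on_config (Suc n) (\<lambda>ys. R (tl ys))"
proof -
  obtain P Q where *: "polynomial_fun n P" "polynomial_fun n Q"
    "\<And>ys. ys \<in> config_space n \<Longrightarrow> Q ys \<noteq> 0 \<and> R ys = P ys / Q ys"
    using assms(1) by (rule rational_on_configE) blast
  have tl: "tl ys \<in> config_space n" if "ys \<in> config_space (Suc n)" for ys
    using that by (cases ys) (auto simp: config_space_def)
  show ?thesis
    by (rule rational_on_config_cong[OF rational_on_config_quotient[OF
            polynomial_fun_tl[OF *(1)] polynomial_fun_tl[OF *(2)]]])
      (use *(3) tl in auto)
qed

lemma rational_on_config_inverse_power:
  assumes "k < n"
  shows "rational_on_config (Suc n) (\<lambda>ys. 1 / (ys ! 0 - ys ! Suc k) ^ j)"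
proof (rule rational_on_config_quotient)
  have "polynomial_fun (Suc n) (\<lambda>ys. ys ! 0 + (- 1) * ys ! Suc k)"
    using assms by (intro polynomial_fun_add polynomial_fun_mult polynomial_fun_nth
        polynomial_fun_const) auto
  then show "polynomial_fun (Suc n) (\<lambda>ys. (ys ! 0 - ys ! Suc k) ^ j)"
    by (intro polynomial_fun_power) simp
  show "(ys ! 0 - ys ! Suc k) ^ j \<noteq> 0" if "ys \<in> config_space (Suc n)" for ys
    using that assms by (auto simp: config_space_def nth_eq_iff_index_eq)
qed (rule polynomial_fun_const)

lemma radially_ordered_config_space: "radially_ordered n \<subseteq> config_space n"
  unfolding radially_ordered_def config_space_def distinct_conv_nth
  by (auto simp: sorted_wrt_iff_nth_less) (metis less_irrefl nat_neq_iff)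

lemma rational_on_config_vanishes:
  assumes "rational_on_config n R" "\<And>ys. ys \<in> radially_ordered n \<Longrightarrow> R ys = 0"
    "ys \<in> config_space n"
  shows "R ys = 0"
proof -
  obtain P Q where *: "polynomial_fun n P"
    "\<And>ys. ys \<in> config_space n \<Longrightarrow> Q ys \<noteq> 0 \<and> R ys = P ys / Q ys"
    using assms(1) by (rule rational_on_configE) blast
  have "P ys = 0"
  proof (rule polynomial_fun_vanishes[OF *(1)])
    show "P ys = 0" if "ys \<in> radially_ordered n" for ys
      using *(2)[OF subsetD[OF radially_ordered_config_space that]] assms(2)[OF that] by auto
    show "length ys = n" using assms(3) by (simp add: config_space_def)
  qed
  then show ?thesis using *(2)[OF assms(3)] by simp
qed

section \<open>Weights and modes\<close>

context vertex_operator_algebra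
begin

lemma mode_left:
  "mode V 0 n w = 0" "mode V (u + v) n w = mode V u n w + mode V v n w"
  "mode V (scal V c u) n w = scal V c (mode V u n w)"
proof -
  interpret module_hom "scal V" "scal V" "\<lambda>u. mode V u n w"
    using mode_linear_left unfolding linear_iff_module_hom .
  show "mode V 0 n w = 0" "mode V (u + v) n w = mode V u n w + mode V v n w"
    "mode V (scal V c u) n w = scal V c (mode V u n w)"
    by (rule zero add scale)+
qed

lemma mode_right:
  "mode V u n 0 = 0" "mode V u n (v + w) = mode V u n v + mode V u n w"
  "mode V u n (v - w) = mode V u n v - mode V u n w"
  "mode V u n (scal V c v) = scal V c (mode V u n v)"
  "mode V u n (sum g S) = (\<Sum>i\<in>S. mode V u n (g i))"
proof -
  interpret module_hom "scal V" "scal V" "mode V u n"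
    using mode_linear_right unfolding linear_iff_module_hom .
  show "mode V u n 0 = 0" "mode V u n (v + w) = mode V u n v + mode V u n w"
    "mode V u n (v - w) = mode V u n v - mode V u n w"
    "mode V u n (scal V c v) = scal V c (mode V u n v)"
    "mode V u n (sum g S) = (\<Sum>i\<in>S. mode V u n (g i))"
    by (rule zero add diff scale sum)+
qed

lemma subspace_wt_space: "subspace (wt_space V n)"
  by (rule subspaceI) (auto simp: wt_space_def vir_def mode_right scale_right_distrib mult.commute)

lemma wt_spaces_induct:
  assumes "subspace (Collect P)" "\<And>n w. w \<in> wt_space V n \<Longrightarrow> P w"
  shows "P w"
proof (rule span_induct[of w "\<Union>n. wt_space V n"])
  show "w \<in> span (\<Union>n. wt_space V n)" by (simp add: grading)
qed (use assms in auto)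

lemma span_wt_spacesE:
  assumes "w \<in> span (\<Union>n\<in>I. wt_space V n)"
  obtains h S where "finite S" "S \<subseteq> I" "\<And>n. h n \<in> wt_space V n" "w = (\<Sum>n\<in>S. h n)"
proof -
  have "\<exists>h S. finite S \<and> S \<subseteq> I \<and> (\<forall>n. h n \<in> wt_space V n) \<and> w = (\<Sum>n\<in>S. h n)"
    using assms
  proof (induction rule: span_induct_alt)
    case base
    show ?case
      using subspace_0[OF subspace_wt_space]
      by (intro exI[of _ "\<lambda>_. 0"] exI[of _ "{}"]) auto
  next
    case (step c x y)
    then obtain m h S where x: "m \<in> I" "x \<in> wt_space V m"
      and y: "finite S" "S \<subseteq> I" "\<forall>n. h n \<in> wt_space V n" "y = (\<Sum>n\<in>S. h n)" by blast
    let ?g = "\<lambda>n. (if n \<in> S then h n else 0) + (if n = m then scal V c x else 0)"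
    have "(\<Sum>n\<in>insert m S. ?g n)
        = (\<Sum>n\<in>insert m S. if n \<in> S then h n else 0) + scal V c x"
      using y(1) by (simp add: sum.distrib del: sum.insert)
    also have "(\<Sum>n\<in>insert m S. if n \<in> S then h n else 0) = y"
      unfolding y(4) using y(1) by (intro sum.mono_neutral_cong_right) auto
    finally have "scal V c x + y = (\<Sum>n\<in>insert m S. ?g n)" by (simp add: add.commute)
    moreover have "?g n \<in> wt_space V n" for n
      using x y(3) by (auto intro!: subspace_add[OF subspace_wt_space]
          subspace_scale[OF subspace_wt_space] subspace_0[OF subspace_wt_space])
    ultimately show ?case using x(1) y(1,2)
      by (intro exI[of _ ?g] exI[of _ "insert m S"]) auto
  qed
  then show thesis using that by blast
qed

text \<open>
  Eigenvectors of \<open>L(0)\<close> to different eigenvalues are linearly independent: applying \<open>L(0) - m\<close>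
  removes the component of weight \<open>m\<close> and rescales the others by non-zero factors.
\<close>

lemma wt_spaces_independent:
  assumes "finite S" "\<And>n. n \<in> S \<Longrightarrow> h n \<in> wt_space V n" "(\<Sum>n\<in>S. h n) = 0"
  shows "\<forall>n\<in>S. h n = 0"
  using assms
proof (induction S arbitrary: h rule: finite_induct)
  case (insert m S)
  have L0: "vir V 0 (h n) = scal V (of_int n) (h n)" if "n \<in> insert m S" for n
    using insert.prems(1)[OF that] by (simp add: wt_space_def)
  have "0 = vir V 0 (\<Sum>n\<in>insert m S. h n) - scal V (of_int m) (\<Sum>n\<in>insert m S. h n)"
    by (simp add: insert.prems(2) vir_def mode_right)
  also have "\<dots> = (\<Sum>n\<in>insert m S. scal V (of_int (n - m)) (h n))"
    using L0 by (simp add: vir_def mode_right scale_sum_right scale_left_diff_distrib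
        sum_subtractf del: sum.insert)
  also have "\<dots> = (\<Sum>n\<in>S. scal V (of_int (n - m)) (h n))"
    using insert.hyps by simp
  finally have "\<forall>n\<in>S. scal V (of_int (n - m)) (h n) = 0"
    using insert.prems(1)
    by (intro insert.IH) (auto intro: subspace_scale[OF subspace_wt_space])
  then have "\<forall>n\<in>S. h n = 0"
    using insert.hyps(2) by (auto simp: scale_eq_0_iff simp del: of_int_diff)
  then show ?case using insert.prems(2) insert.hyps by simp
qed auto

lemma wt_space_disjoint_span:
  assumes "w \<in> wt_space V n" "w \<in> span (\<Union>m\<in>-{n}. wt_space V m)"
  shows "w = 0"
proof -
  obtain h S where h: "finite S" "S \<subseteq> -{n}" "\<And>n. h n \<in> wt_space V n" "w = (\<Sum>m\<in>S. h m)"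
    using span_wt_spacesE[OF assms(2)] by blast
  let ?g = "h(n := - w)"
  have "(\<Sum>m\<in>S. ?g m) = (\<Sum>m\<in>S. h m)"
    using h(2) by (intro sum.cong) auto
  moreover have "n \<notin> S" using h(2) by auto
  ultimately have "(\<Sum>m\<in>insert n S. ?g m) = 0"
    using h(1,4) by simp
  then have "\<forall>m\<in>insert n S. ?g m = 0"
    using assms(1) h(1,3)
    by (intro wt_spaces_independent) (auto intro: subspace_neg[OF subspace_wt_space])
  then show ?thesis by simp
qed

text \<open>
  The Jacobi identity at \<open>l = 0\<close>, where \<open>0 choose i\<close> leaves only \<open>i = 0\<close> on the right.
\<close>

lemma commutator:
  "mode V u (int m) (mode V v n w) = mode V v n (mode V u (int m) w)
     + Sum_any (\<lambda>i::nat. scal V (of_nat (m choose i)) (mode V (mode V u (int i) v) (int m + n - int i) w))"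
proof -
  let ?r = "\<lambda>i::nat. scal V ((-1) ^ i * (of_int 0 gchoose i))
          (mode V u (0 + int m - int i) (mode V v (n + int i) w)
           - scal V ((-1) powi 0) (mode V v (0 + n - int i) (mode V u (int m + int i) w)))"
  have "Sum_any ?r = sum ?r {0}"
    by (rule Sum_any.expand_superset) (auto simp: gbinomial_0_left split: if_splits)
  then show ?thesis
    using jacobi[of "int m" u 0 v n w] by (simp add: binomial_gbinomial algebra_simps)
qed

text \<open>
  Only finitely many terms of the commutator formula survive, either because \<open>u(i)v = 0\<close> for large
  \<open>i\<close> or because \<open>m choose i = 0\<close>; the bound \<open>M\<close> covers both reasons.
\<close>

lemma commutator_finite:
  assumes "\<And>i. M \<le> i \<Longrightarrow> m < i \<or> mode V u (int i) v = 0"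
  shows "mode V u (int m) (mode V v n w) = mode V v n (mode V u (int m) w)
     + (\<Sum>i<M. scal V (of_nat (m choose i)) (mode V (mode V u (int i) v) (int m + n - int i) w))"
proof -
  have "Sum_any (\<lambda>i::nat. scal V (of_nat (m choose i)) (mode V (mode V u (int i) v) (int m + n - int i) w))
    = (\<Sum>i<M. scal V (of_nat (m choose i)) (mode V (mode V u (int i) v) (int m + n - int i) w))"
  proof (rule Sum_any.expand_superset)
    show "{i. scal V (of_nat (m choose i)) (mode V (mode V u (int i) v) (int m + n - int i) w) \<noteq> 0} \<subseteq> {..<M}"
      using assms by (force simp: mode_left binomial_eq_0 not_less[symmetric])
  qed simp
  then show ?thesis by (simp add: commutator)
qed

text \<open>
  The commutator \<open>[L(0), u(m)] = (L(-1)u)(m+1) + (L(0)u)(m)\<close>, with the first summand evaluated by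
  the translation axiom.
\<close>

lemma mode_wt_space:
  assumes "u \<in> wt_space V k" "w \<in> wt_space V l"
  shows "mode V u m w \<in> wt_space V (k + l - m - 1)"
proof -
  have "mode V (conf V) (int 1) (mode V u m w) = mode V u m (mode V (conf V) (int 1) w)
      + (\<Sum>i<2. scal V (of_nat (1 choose i)) (mode V (mode V (conf V) (int i) u) (int 1 + m - int i) w))"
    by (rule commutator_finite) auto
  also have "\<dots> = mode V u m (vir V 0 w) + mode V (vir V (-1) u) (1 + m) w + mode V (vir V 0 u) m w"
    by (simp add: numeral_2_eq_2 vir_def)
  also have "\<dots> = scal V (of_int (k + l - m - 1)) (mode V u m w)"
    using assms by (simp add: wt_space_def translation mode_left mode_right algebra_simps)
  finally show ?thesis by (simp add: wt_space_def vir_def)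
qed

text \<open>The Virasoro relations applied to \<open>\<omega> = L(-2)1\<close>.\<close>

lemma conf_quasiprimary: "quasiprimary V 2 (conf V)"
proof -
  obtain c where vir: "vir V m (vir V n v) - vir V n (vir V m v) =
        scal V (of_int (m - n)) (vir V (m + n) v)
        + (if m + n = 0 then scal V (of_int (m ^ 3 - m) / 12 * c) v else 0)" for m n v
    using virasoro by blast
  have conf: "vir V (-2) (vac V) = conf V"
    by (simp add: vir_def creation)
  have kill: "vir V n (vac V) = 0" if "n \<ge> -1" for n
    using that by (simp add: vir_def creation)
  have "vir V 0 (conf V) = scal V 2 (conf V)" "vir V 1 (conf V) = 0"
    using vir[of 0 "-2" "vac V"] vir[of 1 "-2" "vac V"]
    by (simp_all add: conf kill) (simp_all add: vir_def mode_right)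
  then show ?thesis by (simp add: quasiprimary_def wt_space_def)
qed

lemma wt_component_homogeneous:
  assumes "u \<in> wt_space V N"
  shows "wt_component V u = (\<lambda>k. if k = N then u else 0)"
proof -
  let ?d = "\<lambda>k. if k = N then u else 0"
  have "wt_component V u k = ?d k" for k
    unfolding wt_component_def
  proof (subst the_equality[of _ ?d])
    have "{n. ?d n \<noteq> 0} \<subseteq> {N}" by auto
    then show "(\<forall>n. ?d n \<in> wt_space V n) \<and> finite {n. ?d n \<noteq> 0} \<and> Sum_any ?d = u"
      using assms subspace_0[OF subspace_wt_space] finite_subset
      by (auto simp: Sum_any.expand_superset[of "{N}"])
  next
    fix h assume h: "(\<forall>n. h n \<in> wt_space V n) \<and> finite {n. h n \<noteq> 0} \<and> Sum_any h = u"
    let ?S = "insert N {n. h n \<noteq> 0}"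
    have "(\<Sum>n\<in>?S. h n) = u"
      using h by (subst Sum_any.expand_superset[symmetric]) auto
    then have "(\<Sum>n\<in>?S. h n - ?d n) = 0"
      using h by (simp add: sum_subtractf sum.delta del: sum.insert)
    then have "\<forall>n\<in>?S. h n - ?d n = 0"
      using h assms
      by (intro wt_spaces_independent)
        (auto intro: subspace_diff[OF subspace_wt_space] subspace_0[OF subspace_wt_space])
    then show "h = ?d" by (intro ext) (auto split: if_splits)
  qed simp
  then show ?thesis by blast
qed

text \<open>
  For quasiprimary \<open>u\<close> the exponential \<open>e^(z L(1))\<close> acts trivially, so that a single mode remains.
\<close>

lemma opp_mode_quasiprimary:
  assumes "quasiprimary V N u"
  shows "opp_mode V u n w = scal V ((-1) ^ N) (mode V u (2 * int N - n - 2) w)"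
proof -
  have u: "wt_component V u = (\<lambda>k. if k = int N then u else 0)" "vir V 1 u = 0"
    using assms by (auto simp: quasiprimary_def wt_component_homogeneous)
  have zero: "(vir V 1 ^^ j) 0 = 0" for j
    by (induction j) (auto simp: vir_def mode_right)
  have pos: "(vir V 1 ^^ j) u = 0" if "j > 0" for j
    using that zero by (cases j) (auto simp: u funpow_swap1)
  let ?t = "\<lambda>k j. scal V ((-1) powi k / fact j)
       (mode V ((vir V 1 ^^ j) (wt_component V u k)) (2 * k - int j - n - 2) w)"
  have *: "Sum_any (?t k) = (if k = int N then ?t k 0 else 0)" for k
    by (subst Sum_any.expand_superset[of "{0}"])
      (use pos in \<open>auto simp: u zero mode_left split: if_splits intro: ccontr\<close>)
  show ?thesis
    unfolding opp_mode_def *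
    by (subst Sum_any.expand_superset[of "{int N}"]) (auto simp: u)
qed

section \<open>The invariant form\<close>

text \<open>
  If \<open>h_m\<close> is a non-zero component of \<open>w\<close>, it does not lie in the span of the other weight
  spaces. A linear functional that is 1 on \<open>h_m\<close> and 0 on that span is therefore available, and
  it belongs to the restricted dual since it is supported on a single weight.
\<close>

lemma restricted_dual_separates:
  assumes "w \<noteq> 0"
  obtains f where "f \<in> restricted_dual V" "f w \<noteq> 0"
proof -
  have vs: "vector_space_pair (scal V) ((*) :: complex \<Rightarrow> complex \<Rightarrow> complex)"
    unfolding vector_space_pair_def by (auto simp: vector_space_axioms intro!: vector_space.intro
        simp: algebra_simps)
  have "w \<in> span (\<Union>n\<in>UNIV. wt_space V n)" by (simp add: grading)
  then obtain h S where h: "finite S" "\<And>n. h n \<in> wt_space V n" "w = (\<Sum>n\<in>S. h n)"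
    using span_wt_spacesE by metis
  have "\<exists>m\<in>S. h m \<noteq> 0"
    using assms h(3) by (metis sum.neutral)
  then obtain m where m: "m \<in> S" "h m \<noteq> 0" ..
  let ?U = "\<Union>n\<in>-{m}. wt_space V n"
  obtain C where C: "C \<subseteq> ?U" "independent C" "?U \<subseteq> span C"
    by (rule maximal_independent_subset)
  have sp: "span C = span ?U"
    using C by (metis span_minimal span_mono subset_antisym subspace_span)
  have ind: "independent (insert (h m) C)" "h m \<notin> C"
  proof -
    have "h m \<notin> span C"
      using wt_space_disjoint_span[OF h(2)] m(2) unfolding sp by blast
    then show "independent (insert (h m) C)" "h m \<notin> C"
      using C(2) by (auto simp: independent_insert intro: span_base)
  qed
  obtain f where f: "Vector_Spaces.linear (scal V) (*) f"
      "\<forall>x\<in>insert (h m) C. f x = (if x = h m then 1 else 0 :: complex)"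
    using vector_space_pair.linear_independent_extend[OF vs ind(1),
        of "\<lambda>x. if x = h m then 1 else 0"] by blast
  interpret f: module_hom "scal V" "(*)" f
    using f(1) unfolding linear_iff_module_hom .
  have "f x = 0" if "x \<in> span C" for x
    using that
  proof (rule span_induct)
    show "subspace {x. f x = 0}"
      by (rule subspaceI) (auto simp: f.zero f.add f.scale)
  qed (use f(2) ind in auto)
  then have z: "f x = 0" if "x \<in> wt_space V n" "n \<noteq> m" for x n
    using that C(3) by blast
  have "{n. \<exists>v\<in>wt_space V n. f v \<noteq> 0} \<subseteq> {m}" using z by auto
  then have "f \<in> restricted_dual V"
    unfolding restricted_dual_def using f(1) finite_subset by blast
  moreover have "f w = (\<Sum>n\<in>S. if n = m then 1 else 0)"
    unfolding h(3) f.sum by (intro sum.cong) (use z h(2) f(2) in auto)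
  ultimately show thesis using that m(1) h(1) by simp
qed

text \<open>
  \<open>L(0)\<close> is self-adjoint for an invariant pairing, because \<open>\<omega>\<close> is quasiprimary of weight 2, and it
  annihilates the vacuum.
\<close>

lemma invariant_vacuum_weight:
  assumes "\<And>v. Vector_Spaces.linear (scal V) (*) (B v)"
    and "\<And>w. Vector_Spaces.linear (scal V) (*) (\<lambda>v. B v w)"
    and "\<And>u n v w. B (mode V u n v) w = (B v (opp_mode V u n w) :: complex)"
    and "w \<in> wt_space V n" "n \<noteq> 0"
  shows "B (vac V) w = 0"
proof -
  interpret r: module_hom "scal V" "(*)" "B v" for v
    using assms(1) unfolding linear_iff_module_hom .
  interpret l: module_hom "scal V" "(*)" "\<lambda>v. B v w"
    using assms(2) unfolding linear_iff_module_hom .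
  have "0 = B (mode V (conf V) 1 (vac V)) w"
    by (simp add: creation l.zero)
  also have "\<dots> = B (vac V) (vir V 0 w)"
    by (simp add: assms(3) opp_mode_quasiprimary[OF conf_quasiprimary] vir_def)
  also have "\<dots> = of_int n * B (vac V) w"
    using assms(4) by (simp add: wt_space_def r.scale)
  finally show ?thesis using assms(5) by simp
qed

lemma strong_cft_vacuum_weightE:
  assumes "strong_cft_type V" "w \<in> wt_space V 0"
  obtains c where "w = scal V c (vac V)"
  using assms unfolding strong_cft_type_def by (auto simp: span_singleton)

lemma linear_functional_eqI:
  assumes "Vector_Spaces.linear (scal V) (*) f" "Vector_Spaces.linear (scal V) (*) g"
    and "\<And>n w. w \<in> wt_space V n \<Longrightarrow> f w = (g w :: complex)"
  shows "f w = g w"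
proof (rule wt_spaces_induct)
  interpret f: module_hom "scal V" "(*)" f
    using assms(1) unfolding linear_iff_module_hom .
  interpret g: module_hom "scal V" "(*)" g
    using assms(2) unfolding linear_iff_module_hom .
  show "subspace {w. f w = g w}"
    by (rule subspaceI) (auto simp: f.zero f.add f.scale g.zero g.add g.scale)
qed (rule assms(3))

text \<open>
  The functional \<open>B(1, \<cdot>)\<close> vanishes on non-zero weights and is normalised on \<open>V_0\<close>, which is spanned
  by the vacuum. As \<open>v = v(-1)1\<close>, invariance then determines \<open>B(v, \<cdot>)\<close>.
\<close>

lemma normalized_invariant_form_unique:
  assumes "strong_cft_type V" "normalized_invariant_form V B" "normalized_invariant_form V B'"
  shows "B = B'"
proof (intro ext)
  fix v w
  have B: "\<And>v. Vector_Spaces.linear (scal V) (*) (B v)"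
     "\<And>w. Vector_Spaces.linear (scal V) (*) (\<lambda>v. B v w)"
     "\<And>u n v w. B (mode V u n v) w = B v (opp_mode V u n w)" "B (vac V) (vac V) = 1"
    and B': "\<And>v. Vector_Spaces.linear (scal V) (*) (B' v)"
     "\<And>w. Vector_Spaces.linear (scal V) (*) (\<lambda>v. B' v w)"
     "\<And>u n v w. B' (mode V u n v) w = B' v (opp_mode V u n w)" "B' (vac V) (vac V) = 1"
    using assms(2,3) unfolding normalized_invariant_form_def by simp_all
  have "B (vac V) x = B' (vac V) x" for x
  proof (rule linear_functional_eqI[OF B(1) B'(1)])
    fix n x assume x: "x \<in> wt_space V n"
    show "B (vac V) x = B' (vac V) x"
    proof (cases "n = 0")
      case True
      then obtain c where "x = scal V c (vac V)"
        using x assms(1) by (metis strong_cft_vacuum_weightE)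
      then show ?thesis
        using B(4) B'(4) module_hom.scale[OF B(1)[unfolded linear_iff_module_hom]]
          module_hom.scale[OF B'(1)[unfolded linear_iff_module_hom]] by simp
    next
      case False
      then show ?thesis
        using invariant_vacuum_weight[OF B(1-3) x] invariant_vacuum_weight[OF B'(1-3) x] by simp
    qed
  qed
  then show "B v w = B' v w"
    using B(3)[of v "-1" "vac V" w] B'(3)[of v "-1" "vac V" w] by (simp add: creation)
qed

text \<open>
  The isomorphism \<open>\<phi>\<close> onto the contragredient module defines an invariant pairing \<open>\<phi> v w\<close>. It can be
  normalised because \<open>\<phi> 1\<close>, being non-zero and supported in weight 0, does not vanish on the vacuum.
\<close>

lemma normalized_invariant_form_exists:
  assumes "strong_cft_type V" "iso_to_contragredient V" "vac V \<noteq> 0"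
  obtains B where "normalized_invariant_form V B"
proof -
  obtain \<phi> where \<phi>: "bij_betw \<phi> UNIV (restricted_dual V)"
     "\<And>w. Vector_Spaces.linear (scal V) (*) (\<lambda>v. \<phi> v w)"
     "\<And>u n v. \<phi> (mode V u n v) = contragredient_mode V u n (\<phi> v)"
    using assms(2) unfolding iso_to_contragredient_def by blast
  have lin: "Vector_Spaces.linear (scal V) (*) (\<phi> v)" for v
    using \<phi>(1) unfolding bij_betw_def restricted_dual_def by blast
  interpret r: module_hom "scal V" "(*)" "\<phi> v" for v
    using lin unfolding linear_iff_module_hom .
  interpret l: module_hom "scal V" "(*)" "\<lambda>v. \<phi> v w" for w
    using \<phi>(2) unfolding linear_iff_module_hom .
  have inv: "\<phi> (mode V u n v) w = \<phi> v (opp_mode V u n w)" for u n v w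
    by (simp add: \<phi>(3) contragredient_mode_def)
  have left: "v = 0" if "\<And>w. \<phi> v w = 0" for v
  proof -
    have "\<phi> v = \<phi> 0" using that l.zero by auto
    then show ?thesis using \<phi>(1) unfolding bij_betw_def by (auto dest: injD)
  qed
  have right: "w = 0" if w: "\<And>v. \<phi> v w = 0" for w
  proof (rule ccontr)
    assume "w \<noteq> 0"
    then obtain f where f: "f \<in> restricted_dual V" "f w \<noteq> 0"
      by (rule restricted_dual_separates)
    then obtain v where "f = \<phi> v" using \<phi>(1) unfolding bij_betw_def by blast
    then show False using f(2) w by simp
  qed
  let ?c = "\<phi> (vac V) (vac V)"
  have c: "?c \<noteq> 0"
  proof
    assume c0: "?c = 0"
    have "\<phi> (vac V) w = 0" for w
    proof (rule wt_spaces_induct)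
      show "subspace {w. \<phi> (vac V) w = 0}"
        by (rule subspaceI) (auto simp: r.zero r.add r.scale)
      fix n x assume x: "x \<in> wt_space V n"
      show "\<phi> (vac V) x = 0"
      proof (cases "n = 0")
        case True
        then obtain a where "x = scal V a (vac V)"
          using x assms(1) by (metis strong_cft_vacuum_weightE)
        then show ?thesis using c0 by (simp add: r.scale)
      next
        case False
        show ?thesis by (rule invariant_vacuum_weight[OF lin \<phi>(2) inv x False])
      qed
    qed
    then show False using left assms(3) by blast
  qed
  have "normalized_invariant_form V (\<lambda>v w. \<phi> v w / ?c)"
    unfolding normalized_invariant_form_def linear_iff_module_hom
    using left right c
    by (auto simp: inv l.add l.scale r.add r.scale add_divide_distrib
        intro!: module_hom.intro module_hom_axioms.intro module_axioms
          module_hom.axioms(2)[OF lin[unfolded linear_iff_module_hom]])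
  then show thesis by (rule that)
qed

end

section \<open>Vacuum expectation values\<close>

locale self_dual_cft_voa = vertex_operator_algebra V for V :: "'v::ab_group_add vertex_data" +
  assumes simple: "simple_voa V"
    and strong_cft: "strong_cft_type V"
    and self_dual: "iso_to_contragredient V"
begin

definition vev :: "'v \<Rightarrow> complex" where
  "vev w = invariant_form V (vac V) w"

text \<open>
  If the vacuum were 0, then every \<open>u = u(-1)1\<close> would be 0, but a simple vertex operator algebra is
  not the zero space.
\<close>

lemma normalized_invariant_form: "normalized_invariant_form V (invariant_form V)"
proof -
  have "vac V \<noteq> 0"
  proof
    assume "vac V = 0"
    then have "u = 0" for u :: 'v
      using creation(1)[of u] by (simp add: mode_right)
    then show False using simple unfolding simple_voa_def by blast
  qed
  then obtain B where "normalized_invariant_form V B"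
    using normalized_invariant_form_exists[OF strong_cft self_dual] by blast
  then show ?thesis
    unfolding invariant_form_def
    by (rule theI[of "normalized_invariant_form V" B])
      (rule normalized_invariant_form_unique[OF strong_cft _ \<open>normalized_invariant_form V B\<close>])
qed

lemma linear_invariant_form:
  "Vector_Spaces.linear (scal V) (*) (invariant_form V v)"
  "Vector_Spaces.linear (scal V) (*) (\<lambda>v. invariant_form V v w)"
  and invariance: "invariant_form V (mode V u n v) w = invariant_form V v (opp_mode V u n w)"
  using normalized_invariant_form unfolding normalized_invariant_form_def by simp_all

sublocale vev: module_hom "scal V" "(*)" vev
  using linear_invariant_form(1) unfolding linear_iff_module_hom vev_def .

lemma vev_vac: "vev (vac V) = 1"
  using normalized_invariant_form unfolding normalized_invariant_form_def vev_def by simp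

lemma vev_weight: "w \<in> wt_space V n \<Longrightarrow> n \<noteq> 0 \<Longrightarrow> vev w = 0"
  unfolding vev_def
  by (rule invariant_vacuum_weight[OF linear_invariant_form invariance])

text \<open>
  The adjoint of \<open>u(m)\<close> is \<open>\<plusminus>u(2N-2-m)\<close>, and the modes \<open>u(j)\<close> with \<open>j \<ge> 0\<close> annihilate the vacuum.
\<close>

lemma vev_quasiprimary:
  assumes "quasiprimary V N u" "m \<le> 2 * int N - 2"
  shows "vev (mode V u m w) = 0"
proof -
  interpret l: module_hom "scal V" "(*)" "\<lambda>v. invariant_form V v w"
    using linear_invariant_form(2) unfolding linear_iff_module_hom .
  have "0 = invariant_form V (mode V u (2 * int N - 2 - m) (vac V)) w"
    using assms(2) by (simp add: creation l.zero)
  also have "\<dots> = (-1) ^ N * vev (mode V u m w)"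
    by (simp add: invariance opp_mode_quasiprimary[OF assms(1)] vev_def[symmetric] vev.scale)
  finally show ?thesis by simp
qed

text \<open>
  For \<open>u\<close> of positive weight \<open>k\<close> and \<open>w\<close> of weight \<open>l \<ge> 0\<close>, the weight \<open>k + l - m - 1\<close> of \<open>u(m)w\<close>
  is positive whenever \<open>m < 0\<close>.
\<close>

lemma vev_negative_mode:
  assumes "u \<in> wt_space V k" "k \<ge> 1" "m < 0"
  shows "vev (mode V u m w) = 0"
proof (rule wt_spaces_induct[of "\<lambda>w. vev (mode V u m w) = 0"])
  show "subspace {w. vev (mode V u m w) = 0}"
    by (rule subspaceI) (auto simp: mode_right vev.zero vev.add vev.scale)
  fix n w assume w: "w \<in> wt_space V n"
  show "vev (mode V u m w) = 0"
  proof (cases "n < 0")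
    case True
    then have "w = 0" using w strong_cft unfolding strong_cft_type_def by auto
    then show ?thesis by (simp add: mode_right vev.zero)
  next
    case False
    then show ?thesis using assms by (intro vev_weight[OF mode_wt_space[OF assms(1) w]]) auto
  qed
qed

text \<open>
  Both the multiples of the vacuum and the states of positive weight have such a decomposition,
  the latter by \<open>vev_negative_mode\<close>; the states which have one form a subspace.
\<close>

lemma vacuum_plus_annihilated:
  obtains c u where "a = scal V c (vac V) + u" "\<And>m w. m < 0 \<Longrightarrow> vev (mode V u m w) = 0"
proof -
  let ?Z = "\<lambda>u. \<forall>m<0. \<forall>w. vev (mode V u m w) = 0"
  have "\<exists>c u. a = scal V c (vac V) + u \<and> ?Z u"
  proof (rule wt_spaces_induct[of "\<lambda>a. \<exists>c u. a = scal V c (vac V) + u \<and> ?Z u"])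
    show "subspace {a. \<exists>c u. a = scal V c (vac V) + u \<and> ?Z u}"
    proof (rule subspaceI)
      show "0 \<in> {a. \<exists>c u. a = scal V c (vac V) + u \<and> ?Z u}"
        by (auto intro!: exI[of _ 0] simp: mode_left vev.zero)
    next
      fix x y assume "x \<in> {a. \<exists>c u. a = scal V c (vac V) + u \<and> ?Z u}"
        "y \<in> {a. \<exists>c u. a = scal V c (vac V) + u \<and> ?Z u}"
      then obtain c u d v where "x = scal V c (vac V) + u" "?Z u" "y = scal V d (vac V) + v" "?Z v"
        by blast
      then show "x + y \<in> {a. \<exists>c u. a = scal V c (vac V) + u \<and> ?Z u}"
        by (auto intro!: exI[of _ "c + d"] exI[of _ "u + v"]
            simp: mode_left vev.add scale_left_distrib)
    next
      fix b x assume "x \<in> {a. \<exists>c u. a = scal V c (vac V) + u \<and> ?Z u}"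
      then obtain c u where "x = scal V c (vac V) + u" "?Z u"
        by blast
      then show "scal V b x \<in> {a. \<exists>c u. a = scal V c (vac V) + u \<and> ?Z u}"
        by (auto intro!: exI[of _ "b * c"] exI[of _ "scal V b u"]
            simp: mode_left vev.scale scale_right_distrib)
    qed
  next
    fix n a assume a: "a \<in> wt_space V n"
    consider "n < 0" | "n = 0" | "n \<ge> 1" by linarith
    then show "\<exists>c u. a = scal V c (vac V) + u \<and> ?Z u"
    proof cases
      case 1
      then have "a = 0" using a strong_cft unfolding strong_cft_type_def by auto
      then show ?thesis by (auto intro!: exI[of _ 0] simp: mode_left vev.zero)
    next
      case 2
      then obtain c where "a = scal V c (vac V)"
        using a strong_cft by (metis strong_cft_vacuum_weightE)
      then show ?thesis by (intro exI[of _ c] exI[of _ 0]) (simp add: mode_left vev.zero)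
    next
      case 3
      then show ?thesis
        using vev_negative_mode[OF a] by (auto intro!: exI[of _ 0] exI[of _ a])
    qed
  qed
  then show thesis using that by blast
qed

end

context vertex_operator_algebra
begin

definition mode_string :: "'v list \<Rightarrow> int list \<Rightarrow> 'v" where
  "mode_string vs ms = foldr (\<lambda>(v, m) w. mode V v m w) (zip vs ms) (vac V)"

lemma mode_string_simps [simp]:
  "mode_string [] ms = vac V"
  "mode_string (v # vs) (m # ms) = mode V v m (mode_string vs ms)"
  by (simp_all add: mode_string_def)

text \<open>
  Move \<open>u(m)\<close> through the string by the commutator formula until it reaches the vacuum, which it
  annihilates.
\<close>

lemma mode_string_commutator:
  assumes "length vs = length ms"
    and "\<And>v i. v \<in> set vs \<Longrightarrow> M \<le> i \<Longrightarrow> m < i \<or> mode V u (int i) v = 0"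
  shows "mode V u (int m) (mode_string vs ms) =
    (\<Sum>k<length vs. \<Sum>i<M. scal V (of_nat (m choose i))
       (mode_string (vs[k := mode V u (int i) (vs ! k)]) (ms[k := ms ! k + (int m - int i)])))"
  using assms
proof (induction vs ms rule: list_induct2)
  case Nil
  then show ?case by (simp add: creation)
next
  case (Cons v vs n ms)
  have "mode V u (int m) (mode_string (v # vs) (n # ms))
      = mode V v n (mode V u (int m) (mode_string vs ms))
        + (\<Sum>i<M. scal V (of_nat (m choose i))
            (mode V (mode V u (int i) v) (int m + n - int i) (mode_string vs ms)))"
    using Cons.prems by (simp add: commutator_finite)
  also have "mode V u (int m) (mode_string vs ms) =
    (\<Sum>k<length vs. \<Sum>i<M. scal V (of_nat (m choose i))
       (mode_string (vs[k := mode V u (int i) (vs ! k)]) (ms[k := ms ! k + (int m - int i)])))"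
    using Cons.prems by (intro Cons.IH) auto
  finally show ?case
    by (simp add: sum.lessThan_Suc_shift mode_right algebra_simps del: sum.lessThan_Suc)
qed

end

section \<open>Absolutely convergent Laurent series\<close>

text \<open>The expansion of \<open>(z - y)^(-i-1)\<close> for \<open>|z| > |y|\<close>: the negative binomial series.\<close>

lemma has_sum_negative_binomial:
  fixes y z :: complex
  assumes "norm y < norm z" "y \<noteq> 0"
  shows "((\<lambda>m::nat. of_nat (m choose i) * z powi (- int m - 1) * y powi (int m - int i))
    has_sum 1 / (z - y) ^ Suc i) UNIV"
proof -
  have z: "z \<noteq> 0" using assms by auto
  define x where "x = y / z"
  have x: "norm x < 1" using assms z by (simp add: x_def norm_divide)
  have gb: "(- (of_nat (Suc i)) gchoose j) * (- t) ^ j = of_nat (i + j choose j) * t ^ j"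
    for j and t :: "'a :: field_char_0"
  proof -
    have "(- (of_nat (Suc i)) gchoose j) = (-1 :: 'a) ^ j * of_nat (i + j choose j)"
      by (subst gbinomial_minus) (simp add: binomial_gbinomial)
    then show ?thesis by (simp add: power_minus[of t] algebra_simps power_add[symmetric] mult.left_commute)
  qed
  have "(\<lambda>j. of_nat (i + j choose j) * x ^ j) sums ((1 + - x) powr (- of_nat (Suc i)))"
    using gen_binomial_complex[of "- x" "- of_nat (Suc i)"] x unfolding gb by simp
  also have "(1 + - x) powr (- of_nat (Suc i)) = 1 / (1 - x) ^ Suc i"
    using x by (subst powr_minus) (auto simp: powr_nat' divide_inverse simp del: of_nat_Suc)
  finally have sums: "(\<lambda>j. of_nat (i + j choose j) * x ^ j) sums (1 / (1 - x) ^ Suc i)" .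
  have "summable (\<lambda>j. real (i + j choose j) * norm x ^ j)"
    using gen_binomial_real[of "- norm x" "- real (Suc i)"] x unfolding gb
    by (simp add: sums_iff)
  then have "((\<lambda>j. of_nat (i + j choose j) * x ^ j) has_sum (1 / (1 - x) ^ Suc i)) UNIV"
    using sums by (intro norm_summable_imp_has_sum) (simp_all add: norm_mult norm_power)
  then have *: "((\<lambda>j. z powi (- int i - 1) * (of_nat (i + j choose j) * x ^ j))
      has_sum z powi (- int i - 1) * (1 / (1 - x) ^ Suc i)) UNIV"
    by (rule has_sum_cmult_right)
  have "z powi (- int i - 1) * (1 / (1 - x) ^ Suc i) = 1 / (z - y) ^ Suc i"
  proof -
    have "z powi (- int i - 1) = 1 / z ^ Suc i"
      using power_int_minus[of z "int (Suc i)"] unfolding power_int_of_nat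
      by (simp add: field_simps minus_diff_commute)
    then have "z powi (- int i - 1) * (1 / (1 - x) ^ Suc i) = 1 / (z * (1 - x)) ^ Suc i"
      unfolding power_mult_distrib by simp
    also have "z * (1 - x) = z - y" using z by (simp add: x_def field_simps)
    finally show ?thesis .
  qed
  then have "((\<lambda>j. z powi (- int i - 1) * (of_nat (i + j choose j) * x ^ j))
      has_sum 1 / (z - y) ^ Suc i) UNIV"
    using * by simp
  also have "?this \<longleftrightarrow> ((\<lambda>m::nat. of_nat (m choose i) * z powi (- int m - 1) * y powi (int m - int i))
    has_sum 1 / (z - y) ^ Suc i) {i..}"
  proof (rule has_sum_reindex_bij_witness[of _ "\<lambda>m. m - i" "\<lambda>j. i + j"])
    fix j :: nat
    have "z powi (- int (i + j) - 1) = z powi (- int i - 1) * z powi (- int j)"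
      using power_int_add[of z "- int i - 1" "- int j"] z by (simp add: algebra_simps)
    moreover have "x ^ j = z powi (- int j) * y ^ j"
      using z by (simp add: x_def power_divide power_int_minus field_simps)
    moreover have "(i + j choose i) = (i + j choose j)"
      using binomial_symmetric[of j "i + j"] by simp
    ultimately show "of_nat (i + j choose i) * z powi (- int (i + j) - 1) * y powi (int (i + j) - int i)
       = z powi (- int i - 1) * (of_nat (i + j choose j) * x ^ j)"
      by simp
  qed auto
  also have "\<dots> \<longleftrightarrow> ?thesis"
    by (rule has_sum_cong_neutral) auto
  finally show ?thesis .
qed

lemma has_sum_mult_Times:
  fixes f :: "'a \<Rightarrow> complex" and g :: "'b \<Rightarrow> complex"
  assumes "(f has_sum a) A" "(g has_sum b) B"
  shows "((\<lambda>(x, y). f x * g y) has_sum a * b) (A \<times> B)"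
proof (rule has_sum_SigmaI)
  show "((\<lambda>y. case (x, y) of (x, y) \<Rightarrow> f x * g y) has_sum f x * b) B" for x
    using has_sum_cmult_right[OF assms(2)] by simp
  show "((\<lambda>x. f x * b) has_sum a * b) A"
    by (rule has_sum_cmult_left[OF assms(1)])
  have f: "f abs_summable_on A" and g: "g abs_summable_on B"
    using assms by (auto simp: summable_on_iff_abs_summable_on_complex[symmetric] summable_on_def)
  have "(\<lambda>(x, y). f x * g y) abs_summable_on A \<times> B"
    unfolding abs_summable_on_Sigma_iff
    using f g summable_on_cmult_left[OF f]
    by (auto simp: norm_mult infsum_cmult_right' summable_on_cmult_right abs_mult
        infsum_nonneg)
  then show "(\<lambda>(x, y). f x * g y) summable_on A \<times> B"
    by (rule abs_summable_summable)
qed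

definition laurent_monom :: "complex list \<Rightarrow> int list \<Rightarrow> complex" where
  "laurent_monom ys ms = (\<Prod>i<length ys. (ys ! i) powi (- (ms ! i) - 1))"

lemma laurent_monom_Cons:
  "laurent_monom (y # ys) (m # ms) = y powi (- m - 1) * laurent_monom ys ms"
  by (simp add: laurent_monom_def prod.lessThan_Suc_shift del: prod.lessThan_Suc)

lemma laurent_monom_shift:
  assumes "k < length ys" "length ms = length ys" "ys ! k \<noteq> 0"
  shows "laurent_monom ys (ms[k := ms ! k - d]) = (ys ! k) powi d * laurent_monom ys ms"
proof -
  have "laurent_monom ys (ms[k := ms ! k - d])
      = (\<Prod>i<length ys. (if i = k then (ys ! k) powi d else 1) * (ys ! i) powi (- (ms ! i) - 1))"
    unfolding laurent_monom_def using assms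
    by (intro prod.cong) (auto simp: nth_list_update power_int_add[symmetric] algebra_simps)
  then show ?thesis
    using assms(1) by (simp add: prod.distrib prod.delta laurent_monom_def)
qed

text \<open>
  This converts the shifts of mode numbers produced by the commutator formula into the powers of
  \<open>y_k\<close> that occur in the recursion and in the Ward identity.
\<close>

lemma has_sum_shift:
  assumes "((\<lambda>ms. C ms * laurent_monom ys ms) has_sum S) {ms. length ms = n}"
    and "length ys = n" "k < n" "ys ! k \<noteq> 0"
  shows "((\<lambda>ms. C (ms[k := ms ! k + d]) * laurent_monom ys ms) has_sum (ys ! k) powi d * S)
    {ms. length ms = n}"
proof -
  have "((\<lambda>ms. (ys ! k) powi d * (C ms * laurent_monom ys ms)) has_sum (ys ! k) powi d * S)
      {ms. length ms = n}"
    by (rule has_sum_cmult_right[OF assms(1)])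
  also have "?this \<longleftrightarrow> ?thesis"
    using assms
    by (intro has_sum_reindex_bij_witness[of _ "\<lambda>ms. ms[k := ms ! k + d]" "\<lambda>ms. ms[k := ms ! k - d]"])
      (auto simp: laurent_monom_shift)
  finally show ?thesis .
qed

lemma has_sum_sum_same:
  fixes f :: "'a \<Rightarrow> 'b \<Rightarrow> complex"
  assumes "\<And>j. j \<in> J \<Longrightarrow> (f j has_sum s j) A"
  shows "((\<lambda>x. \<Sum>j\<in>J. f j x) has_sum (\<Sum>j\<in>J. s j)) A"
  using assms by (induction J rule: infinite_finite_induct) (auto intro: has_sum_add)

section \<open>Convergence and rationality of the correlators\<close>

context self_dual_cft_voa
begin

lemma correlator_coeff_vev: "correlator_coeff V vs ms = vev (mode_string vs ms)"
  by (simp add: correlator_coeff_def vev_def mode_string_def)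

text \<open>
  Each summand of the commutator formula factors, after a shift of the \<open>k\<close>-th exponent by \<open>m - i\<close>,
  into a negative binomial series in \<open>y_k/z\<close>, summed over the mode number \<open>m\<close> of the new
  insertion, and a correlator series with one insertion less.
\<close>

lemma has_sum_commutator_term:
  assumes C: "((\<lambda>ms. C ms * laurent_monom ys ms) has_sum S) {ms. length ms = n}"
    and "length ys = n" "k < n" "ys ! k \<noteq> 0" "norm (ys ! k) < norm z"
  shows "((\<lambda>(m::nat, ms). of_nat (m choose i) * C (ms[k := ms ! k + (int m - int i)])
            * laurent_monom (z # ys) (int m # ms))
          has_sum 1 / (z - ys ! k) ^ Suc i * S) (UNIV \<times> {ms. length ms = n})"
proof -
  let ?F = "\<lambda>m::nat. of_nat (m choose i) * z powi (- int m - 1) * (ys ! k) powi (int m - int i)"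
  have "((\<lambda>(m, ms). ?F m * (C ms * laurent_monom ys ms))
      has_sum 1 / (z - ys ! k) ^ Suc i * S) (UNIV \<times> {ms. length ms = n})"
    by (rule has_sum_mult_Times[OF has_sum_negative_binomial C]) (use assms in auto)
  also have "?this \<longleftrightarrow> ?thesis"
    using assms(2-4)
    by (intro has_sum_reindex_bij_witness
        [of _ "\<lambda>(m, ms). (m, ms[k := ms ! k + (int m - int i)])"
              "\<lambda>(m, ms). (m, ms[k := ms ! k - (int m - int i)])"])
      (auto simp: laurent_monom_shift laurent_monom_Cons)
  finally show ?thesis .
qed

text \<open>
  The condition that characterises the correlator among functions on the configuration space. It
  does not mention the values elsewhere, so that witnesses can be given by plain formulas.
\<close>

definition correlator_expansion :: "'v list \<Rightarrow> (complex list \<Rightarrow> complex) \<Rightarrow> bool" where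
  "correlator_expansion vs R \<longleftrightarrow> rational_on_config (length vs) R \<and>
     (\<forall>ys\<in>radially_ordered (length vs).
       ((\<lambda>ms. correlator_coeff V vs ms * laurent_monom ys ms) has_sum R ys)
         {ms. length ms = length vs})"

text \<open>
  The recursion that removes the first insertion. The vacuum part of \<open>a\<close> contributes only through
  its mode \<open>-1\<close>, which is the identity, and the remainder \<open>u\<close> only through the modes \<open>u(m)\<close> with
  \<open>m \<ge> 0\<close>, to which the commutator formula applies.
\<close>

lemma correlator_expansion_Cons:
  assumes a: "a = scal V c (vac V) + u" "\<And>m w. m < 0 \<Longrightarrow> vev (mode V u m w) = 0"
    and M: "\<And>v i. v \<in> set vs \<Longrightarrow> M \<le> i \<Longrightarrow> mode V u (int i) v = 0"
    and R: "correlator_expansion vs R"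
    and S: "\<And>k i. k < length vs \<Longrightarrow> i < M \<Longrightarrow>
        correlator_expansion (vs[k := mode V u (int i) (vs ! k)]) (S k i)"
  shows "correlator_expansion (a # vs) (\<lambda>ys. c * R (tl ys) +
    (\<Sum>k<length vs. \<Sum>i<M. 1 / (ys ! 0 - ys ! Suc k) ^ Suc i * S k i (tl ys)))"
    (is "correlator_expansion _ ?T")
proof -
  let ?n = "length vs"
  have "rational_on_config (Suc ?n) ?T"
    using R S unfolding correlator_expansion_def
    by (intro rational_on_config_add rational_on_config_mult rational_on_config_sum
        rational_on_config_tl rational_on_config_inverse_power
        rational_on_config_polynomial[OF polynomial_fun_const]) auto
  moreover have "((\<lambda>ms. correlator_coeff V (a # vs) ms * laurent_monom ys ms) has_sum ?T ys)
         {ms. length ms = Suc ?n}" if ys: "ys \<in> radially_ordered (Suc ?n)" for ys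
  proof -
    obtain z ys' where z: "ys = z # ys'" using ys by (cases ys) (auto simp: radially_ordered_def)
    have ys': "ys' \<in> radially_ordered ?n" "length ys' = ?n" "z \<noteq> 0"
      "\<And>k. k < ?n \<Longrightarrow> ys' ! k \<noteq> 0 \<and> norm (ys' ! k) < norm z"
      using ys by (auto simp: radially_ordered_def z) (metis nth_mem)
    let ?L = "{ms :: int list. length ms = ?n}"
    let ?f = "\<lambda>ms. vev (mode V u (hd ms) (mode_string vs (tl ms))) * laurent_monom ys ms"
    let ?g = "\<lambda>ms. (if hd ms = -1 then c * vev (mode_string vs (tl ms)) else 0) * laurent_monom ys ms"
    \<comment> \<open>The vacuum part: only \<open>m = -1\<close>, whose monomial \<open>z^(-m-1)\<close> is 1.\<close>
    have "((\<lambda>ms. c * (correlator_coeff V vs ms * laurent_monom ys' ms)) has_sum c * R ys') ?L"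
      using R ys' unfolding correlator_expansion_def by (intro has_sum_cmult_right) auto
    also have "?this \<longleftrightarrow> (?g has_sum c * R ys') ((#) (-1) ` ?L)"
      by (intro has_sum_reindex_bij_witness[of _ tl "(#) (-1)"])
        (auto simp: correlator_coeff_vev laurent_monom_Cons z)
    also have "\<dots> \<longleftrightarrow> (?g has_sum c * R ys') {ms. length ms = Suc ?n}"
    proof (rule has_sum_cong_neutral)
      fix ms assume "ms \<in> {ms. length ms = Suc ?n} - (#) (-1) ` ?L"
      then have "hd ms \<noteq> -1" by (cases ms) auto
      then show "?g ms = 0" by simp
    qed auto
    finally have g: "(?g has_sum c * R ys') {ms. length ms = Suc ?n}" .
    let ?t = "\<lambda>k i. \<lambda>(m::nat, ms). of_nat (m choose i)
        * correlator_coeff V (vs[k := mode V u (int i) (vs ! k)]) (ms[k := ms ! k + (int m - int i)])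
        * laurent_monom (z # ys') (int m # ms)"
    let ?s = "\<Sum>k<?n. \<Sum>i<M. 1 / (z - ys' ! k) ^ Suc i * S k i ys'"
    \<comment> \<open>The remainder: non-negative modes are indexed by \<open>nat\<close>, negative ones contribute 0.\<close>
    have "((\<lambda>p. \<Sum>k<?n. \<Sum>i<M. ?t k i p) has_sum ?s) (UNIV \<times> ?L)"
    proof (intro has_sum_sum_same)
      fix k i assume "k \<in> {..<?n}" "i \<in> {..<M}"
      then show "(?t k i has_sum 1 / (z - ys' ! k) ^ Suc i * S k i ys') (UNIV \<times> ?L)"
        using ys' S[of k i] unfolding correlator_expansion_def
        by (intro has_sum_commutator_term) auto
    qed
    also have "?this \<longleftrightarrow> (?f has_sum ?s) ((\<lambda>(m, ms). int m # ms) ` (UNIV \<times> ?L))"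
    proof (intro has_sum_reindex_bij_witness[of _ "\<lambda>ms. (nat (hd ms), tl ms)" "\<lambda>(m, ms). int m # ms"])
      fix p :: "nat \<times> int list" assume "p \<in> UNIV \<times> ?L"
      then obtain m ms where p: "p = (m, ms)" "length ms = ?n" by auto
      have "mode V u (int m) (mode_string vs ms) =
        (\<Sum>k<?n. \<Sum>i<M. scal V (of_nat (m choose i))
       (mode_string (vs[k := mode V u (int i) (vs ! k)]) (ms[k := ms ! k + (int m - int i)])))"
        using p(2) M by (intro mode_string_commutator) auto
      then show "?f (case p of (m, ms) \<Rightarrow> int m # ms) = (\<Sum>k<?n. \<Sum>i<M. ?t k i p)"
        by (simp add: p(1) z vev.sum vev.scale correlator_coeff_vev sum_distrib_right)
    qed auto
    also have "\<dots> \<longleftrightarrow> (?f has_sum ?s) {ms. length ms = Suc ?n}"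
    proof (rule has_sum_cong_neutral)
      fix ms assume ms: "ms \<in> {ms. length ms = Suc ?n} - (\<lambda>(m, ms). int m # ms) ` (UNIV \<times> ?L)"
      then obtain m ms' where m: "ms = m # ms'" "length ms' = ?n" by (cases ms) auto
      have "m < 0"
      proof (rule ccontr)
        assume "\<not> m < 0"
        then have "ms = (\<lambda>(m, ms). int m # ms) (nat m, ms')" by (simp add: m)
        then show False using ms m(2) by blast
      qed
      then show "?f ms = 0" using a(2) by (simp add: m)
    qed auto
    finally have f: "(?f has_sum ?s) {ms. length ms = Suc ?n}" .
    have "((\<lambda>ms. ?g ms + ?f ms) has_sum c * R ys' + ?s) {ms. length ms = Suc ?n}"
      by (rule has_sum_add[OF g f])
    also have "?this \<longleftrightarrow> ((\<lambda>ms. correlator_coeff V (a # vs) ms * laurent_monom ys ms)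
        has_sum c * R ys' + ?s) {ms. length ms = Suc ?n}"
    proof (rule has_sum_cong)
      fix ms :: "int list" assume "ms \<in> {ms. length ms = Suc ?n}"
      then obtain m ms' where m: "ms = m # ms'" by (cases ms) auto
      show "?g ms + ?f ms = correlator_coeff V (a # vs) ms * laurent_monom ys ms"
        by (simp add: m a(1) correlator_coeff_vev mode_left vacuum vev.add vev.scale vev.zero
            distrib_right)
    qed
    finally show ?thesis by (simp add: z)
  qed
  ultimately show ?thesis by (simp add: correlator_expansion_def)
qed

lemma correlator_expansion_exists: "\<exists>R. correlator_expansion vs R"
proof (induction "length vs" arbitrary: vs)
  case 0
  have "correlator_expansion [] (\<lambda>_. 1)"
    unfolding correlator_expansion_def
    by (auto intro!: rational_on_config_polynomial polynomial_fun_const has_sum_finiteI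
        simp: correlator_coeff_vev vev_vac laurent_monom_def radially_ordered_def)
  then show ?case using 0 by auto
next
  case (Suc n)
  then obtain a bs where vs: "vs = a # bs" "length bs = n" by (cases vs) auto
  obtain c u where u: "a = scal V c (vac V) + u" "\<And>m w. m < 0 \<Longrightarrow> vev (mode V u m w) = 0"
    by (rule vacuum_plus_annihilated[of a]) blast
  obtain b where b: "\<And>v k. b v \<le> k \<Longrightarrow> mode V u k v = 0"
    using truncation[of u] by metis
  \<comment> \<open>A uniform bound beyond which \<open>u(i)\<close> annihilates every remaining insertion.\<close>
  define M where "M = Max (insert 0 ((\<lambda>v. nat (b v)) ` set bs))"
  have M: "mode V u (int i) v = 0" if "v \<in> set bs" "M \<le> i" for v i
  proof -
    have "nat (b v) \<le> M" unfolding M_def using that(1) by (intro Max_ge) auto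
    then show ?thesis using that(2) by (intro b) auto
  qed
  have "\<forall>vs. \<exists>R. length vs = n \<longrightarrow> correlator_expansion vs R"
    using Suc.hyps(1) by blast
  then obtain R where R: "\<And>vs. length vs = n \<Longrightarrow> correlator_expansion vs (R vs)"
    by metis
  show ?case
    unfolding vs(1)
    by (rule exI, rule correlator_expansion_Cons[OF u M,
          where R = "R bs" and S = "\<lambda>k i. R (bs[k := mode V u (int i) (bs ! k)])"])
      (use vs(2) R in auto)
qed

lemma correlator_expansion_unique:
  assumes "correlator_expansion vs R" "correlator_expansion vs R'" "ys \<in> config_space (length vs)"
  shows "R ys = R' ys"
proof -
  have "rational_on_config (length vs) (\<lambda>ys. R ys + (- 1) * R' ys)"
    using assms unfolding correlator_expansion_def
    by (intro rational_on_config_add rational_on_config_mult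
        rational_on_config_polynomial[OF polynomial_fun_const]) auto
  moreover have "R ys + (- 1) * R' ys = 0" if "ys \<in> radially_ordered (length vs)" for ys
    using assms that has_sum_unique unfolding correlator_expansion_def by fastforce
  ultimately show ?thesis
    using rational_on_config_vanishes assms(3) by force
qed

lemma correlator_expansion_correlator: "correlator_expansion vs (correlator V vs)"
proof -
  let ?n = "length vs"
  let ?P = "\<lambda>R. R \<in> extensional (config_space ?n) \<and> correlator_expansion vs R"
  have rad: "radially_ordered ?n \<subseteq> config_space ?n"
    by (rule radially_ordered_config_space)
  obtain R where R: "correlator_expansion vs R"
    using correlator_expansion_exists by blast
  have "?P (restrict R (config_space ?n))"
    using R rad unfolding correlator_expansion_def
    by (auto intro: rational_on_config_cong)
  moreover have "R1 = R2" if "?P R1" "?P R2" for R1 R2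
    using that correlator_expansion_unique by (intro extensionalityI[of _ "config_space ?n"]) auto
  ultimately have "?P (THE R. ?P R)"
    by (intro theI[of ?P]) blast+
  also have "(THE R. ?P R) = correlator V vs"
    unfolding correlator_def Let_def correlator_expansion_def
    by (intro arg_cong[where f = The] ext)
      (auto simp: laurent_monom_def radially_ordered_def cong: conj_cong)
  finally show ?thesis by blast
qed

section \<open>The Ward identity\<close>

text \<open>
  The case \<open>p(y) = y^m\<close>. On the radially ordered region, the left-hand side is the sum of the series
  with coefficients \<open>\<langle>1, u(m) v_1(m_1) \<dots> v_n(m_n) 1\<rangle>\<close>, all of which vanish; both the bound on \<open>m\<close>
  and the hypothesis that \<open>u\<close> is quasiprimary enter here.
\<close>

lemma correlator_monomial_identity:
  assumes u: "quasiprimary V N u" "N \<ge> 1" and m: "m \<le> 2 * N - 2"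
    and ys: "ys \<in> config_space (length vs)"
  shows "(\<Sum>k<length vs. \<Sum>l<Suc (2 * N - 2). of_nat (m choose l) * ys ! k ^ (m - l)
             * correlator V (vs[k := mode V u (int l) (vs ! k)]) ys) = 0"
proof (rule rational_on_config_vanishes[OF _ _ ys])
  let ?n = "length vs" and ?M = "Suc (2 * N - 2)"
  let ?v = "\<lambda>k l. vs[k := mode V u (int l) (vs ! k)]"
  have E: "correlator_expansion (?v k l) (correlator V (?v k l))" for k l
    by (rule correlator_expansion_correlator)
  have rational: "rational_on_config ?n (correlator V (?v k l))" for k l
    using E unfolding correlator_expansion_def by simp
  show "rational_on_config ?n (\<lambda>ys. \<Sum>k<?n. \<Sum>l<?M. of_nat (m choose l) * ys ! k ^ (m - l)
             * correlator V (?v k l) ys)"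
    by (intro rational_on_config_sum rational_on_config_mult rational rational_on_config_polynomial
        polynomial_fun_const polynomial_fun_power polynomial_fun_nth) auto
  fix ys assume ys: "ys \<in> radially_ordered ?n"
  then have len: "length ys = ?n" and nz: "\<And>k. k < ?n \<Longrightarrow> ys ! k \<noteq> 0"
    by (auto simp: radially_ordered_def) (metis nth_mem)
  let ?C = "\<lambda>k l ms. of_nat (m choose l) * (correlator_coeff V (?v k l)
      (ms[k := ms ! k + (int m - int l)]) * laurent_monom ys ms)"
  have series: "((\<lambda>ms. \<Sum>k<?n. \<Sum>l<?M. ?C k l ms) has_sum
     (\<Sum>k<?n. \<Sum>l<?M. of_nat (m choose l) * ((ys ! k) powi (int m - int l) * correlator V (?v k l) ys)))
     {ms. length ms = ?n}"
  proof (intro has_sum_sum_same has_sum_cmult_right has_sum_shift)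
    show "((\<lambda>ms. correlator_coeff V (?v k l) ms * laurent_monom ys ms)
        has_sum correlator V (?v k l) ys) {ms. length ms = ?n}" for k l
      using E[of k l] ys unfolding correlator_expansion_def by simp
  qed (use len nz in auto)
  have zero: "(\<Sum>k<?n. \<Sum>l<?M. ?C k l ms) = 0" if "length ms = ?n" for ms
  proof -
    have "mode V u (int m) (mode_string vs ms) =
        (\<Sum>k<?n. \<Sum>l<?M. scal V (of_nat (m choose l))
           (mode_string (?v k l) (ms[k := ms ! k + (int m - int l)])))"
      using that m by (intro mode_string_commutator) auto
    then have "(\<Sum>k<?n. \<Sum>l<?M. ?C k l ms)
        = vev (mode V u (int m) (mode_string vs ms)) * laurent_monom ys ms"
      by (simp only: vev.sum vev.scale correlator_coeff_vev sum_distrib_right mult.assoc)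
    also have "vev (mode V u (int m) (mode_string vs ms)) = 0"
      using m u(2) by (intro vev_quasiprimary[OF u(1)]) auto
    finally show ?thesis by simp
  qed
  have "((\<lambda>ms. 0) has_sum (\<Sum>k<?n. \<Sum>l<?M. of_nat (m choose l) * ((ys ! k) powi (int m - int l) * correlator V (?v k l) ys)))
     {ms :: int list. length ms = ?n}"
    by (rule has_sum_cong[THEN iffD1, OF _ series]) (simp only: zero mem_Collect_eq)
  then have "(\<Sum>k<?n. \<Sum>l<?M. of_nat (m choose l) * ((ys ! k) powi (int m - int l) * correlator V (?v k l) ys)) = 0"
    by (rule has_sum_unique) (rule has_sum_0, simp)
  moreover have "of_nat (m choose l) * ((ys ! k) powi (int m - int l) * x)
      = of_nat (m choose l) * ys ! k ^ (m - l) * x" for k l x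
    by (cases "l \<le> m") (auto simp: of_nat_diff[symmetric] simp del: of_nat_diff)
  ultimately show "(\<Sum>k<?n. \<Sum>l<?M. of_nat (m choose l) * ys ! k ^ (m - l) * correlator V (?v k l) ys) = 0"
    by (simp only:)
qed

end

lemma poly_higher_pderiv_fact:
  fixes p :: "complex poly"
  assumes "degree p \<le> d"
  shows "poly ((pderiv ^^ l) p) y / fact l = (\<Sum>m\<le>d. coeff p m * (of_nat (m choose l) * y ^ (m - l)))"
proof -
  have mon: "poly ((pderiv ^^ l) (monom 1 m)) y / fact l = of_nat (m choose l) * y ^ (m - l)" for m
  proof -
    have "Suc l * (m choose Suc l) = (m - l) * (m choose l)" for l
      by (simp only: binomial_absorption binomial_absorb_comp)
    then have step: "of_nat (m - l) * (fact l * of_nat (m choose l))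
        = (fact (Suc l) * of_nat (m choose Suc l) :: complex)" for l
      by (simp only: fact_Suc of_nat_mult[symmetric] mult.assoc mult.left_commute[of _ "fact l"])
    have "(pderiv ^^ l) (monom 1 m) = monom (fact l * of_nat (m choose l) :: complex) (m - l)"
    proof (induction l)
      case (Suc l)
      then show ?case by (simp only: funpow.simps o_apply pderiv_monom step) simp
    qed simp
    then show ?thesis by (simp add: poly_monom)
  qed
  have "p = (\<Sum>m\<le>d. smult (coeff p m) (monom 1 m))"
    using poly_as_sum_of_monoms'[OF assms] by (simp add: smult_monom)
  then have "poly ((pderiv ^^ l) p) y / fact l
      = poly ((pderiv ^^ l) (\<Sum>m\<le>d. smult (coeff p m) (monom 1 m))) y / fact l"
    by simp
  also have "\<dots> = (\<Sum>m\<le>d. coeff p m * (poly ((pderiv ^^ l) (monom 1 m)) y / fact l))"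
    by (simp add: higher_pderiv_sum higher_pderiv_smult poly_sum sum_divide_distrib)
  finally show ?thesis unfolding mon .
qed

theorem proposition3p3:
  fixes V :: "'v::ab_group_add vertex_data"
    and u :: 'v and N n :: nat and vs :: "'v list" and ys :: "complex list" and p :: "complex poly"
  assumes "vertex_operator_algebra V"
    and "simple_voa V"
    and "strong_cft_type V"
    and "iso_to_contragredient V"
    and "N \<ge> 1"
    and "quasiprimary V N u"
    and "length vs = n"
    and "ys \<in> config_space n"
    and "degree p \<le> 2 * N - 2"
  shows "(\<Sum>k<n. \<Sum>l=0..2 * N - 2.
           poly ((pderiv ^^ l) p) (ys ! k) / fact l
             * correlator V (vs[k := mode V u (int l) (vs ! k)]) ys) = 0"
proof -
  interpret self_dual_cft_voa V
    using assms(1-4) by (simp add: self_dual_cft_voa_def self_dual_cft_voa_axioms_def)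
  let ?d = "2 * N - 2"
  let ?Z = "\<lambda>k l. correlator V (vs[k := mode V u (int l) (vs ! k)]) ys"
  have "(\<Sum>k<n. \<Sum>l=0..?d. poly ((pderiv ^^ l) p) (ys ! k) / fact l * ?Z k l)
      = (\<Sum>k<n. \<Sum>l<Suc ?d. \<Sum>m\<le>?d. coeff p m * (of_nat (m choose l) * ys ! k ^ (m - l) * ?Z k l))"
    unfolding poly_higher_pderiv_fact[OF assms(9)]
    by (simp add: sum_distrib_right mult.assoc atLeast0AtMost lessThan_Suc_atMost del: sum.lessThan_Suc)
  also have "\<dots> = (\<Sum>m\<le>?d. \<Sum>k<n. \<Sum>l<Suc ?d. coeff p m * (of_nat (m choose l) * ys ! k ^ (m - l) * ?Z k l))"
    by (subst sum.swap[of _ "{..?d}"], intro sum.cong refl sum.swap)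
  also have "\<dots> = (\<Sum>m\<le>?d. coeff p m *
      (\<Sum>k<n. \<Sum>l<Suc ?d. of_nat (m choose l) * ys ! k ^ (m - l) * ?Z k l))"
    by (simp add: sum_distrib_left del: sum.lessThan_Suc)
  also have "\<dots> = 0"
    using correlator_monomial_identity[OF assms(6,5), of _ ys vs] assms(7,8)
    by (intro sum.neutral) (simp del: sum.lessThan_Suc)
  finally show ?thesis .
qed

end
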